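(* Let $k\ge 2$ and let $\mathcal{F}=(V,\mathcal{E})$ be a $k$-uniform edge-minimal hypertree on $n=|V|$ vertices. Then $|\mathcal{E}|\le \frac{n(n-1)(n-k+1)}{2}$.
   Context: A $k$-uniform hypergraph $\mathcal{H}=(V,\mathcal{E})$ consists of a finite vertex set $V$ and a set $\mathcal{E}$ of $k$-element subsets of $V$ (no multiple edges). A $k$-uniform hypergraph is a chain if there is a sequence $v_1,\dots,v_l$ of its vertices in which every vertex appears at least once (possibly more times), $v_1\ne v_l$, and its edge set consists of exactly the $l-k+1$ distinct sets $\{v_i,\dots,v_{i+k-1}\}$, $1\le i\le l-k+1$; it is a semicycle if the same holds with $v_1=v_l$ instead. $\mathcal{H}$ is chain-connected if every pair of distinct vertices is contained in some subhypergraph of $\mathcal{H}$ that is a chain; semicycle-free if no subhypergraph is a semicycle. A hypertree is a chain-connected, semicycle-free $k$-uniform hypergraph. An edge-minimal hypertree is a hypertree $(V,\mathcal{E})$ such that for every $e\in\mathcal{E}$, $(V,\mathcal{E}\setminus\{e\})$ is not a hypertree. *)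

theory Defs
  imports Complex_Main
begin

definition uniform_hypergraph :: "nat \<Rightarrow> 'a set \<Rightarrow> 'a set set \<Rightarrow> bool" where
  "uniform_hypergraph k V E \<longleftrightarrow> finite V \<and> (\<forall>e\<in>E. e \<subseteq> V \<and> card e = k)"

definition subhypergraph :: "'a set \<Rightarrow> 'a set set \<Rightarrow> 'a set \<Rightarrow> 'a set set \<Rightarrow> bool" where
  "subhypergraph V' E' V E \<longleftrightarrow> V' \<subseteq> V \<and> E' \<subseteq> E \<and> (\<forall>e\<in>E'. e \<subseteq> V')"

definition window :: "nat \<Rightarrow> 'a list \<Rightarrow> nat \<Rightarrow> 'a set" where
  "window k vs i = (\<lambda>j. vs ! j) ` {i..<i + k}"

(* Indices start at 0, so the length vs - k + 1 windows begin at 0, ..., length vs - k.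
   The condition k \<le> length vs says that there is at least one window. Without it, a
   sequence of k - 1 vertices would be an edgeless chain (or semicycle). *)
definition window_sequence :: "nat \<Rightarrow> 'a set \<Rightarrow> 'a set set \<Rightarrow> 'a list \<Rightarrow> bool" where
  "window_sequence k V E vs \<longleftrightarrow>
     k \<le> length vs \<and> set vs = V \<and>
     inj_on (window k vs) {0..length vs - k} \<and>
     E = window k vs ` {0..length vs - k}"

definition chain :: "nat \<Rightarrow> 'a set \<Rightarrow> 'a set set \<Rightarrow> bool" where
  "chain k V E \<longleftrightarrow> uniform_hypergraph k V E \<and>
     (\<exists>vs. window_sequence k V E vs \<and> hd vs \<noteq> last vs)"

definition semicycle :: "nat \<Rightarrow> 'a set \<Rightarrow> 'a set set \<Rightarrow> bool" where
  "semicycle k V E \<longleftrightarrow> uniform_hypergraph k V E \<and>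
     (\<exists>vs. window_sequence k V E vs \<and> hd vs = last vs)"

definition chain_connected :: "nat \<Rightarrow> 'a set \<Rightarrow> 'a set set \<Rightarrow> bool" where
  "chain_connected k V E \<longleftrightarrow>
     (\<forall>u\<in>V. \<forall>v\<in>V. u \<noteq> v \<longrightarrow>
        (\<exists>V' E'. subhypergraph V' E' V E \<and> chain k V' E' \<and> u \<in> V' \<and> v \<in> V'))"

definition semicycle_free :: "nat \<Rightarrow> 'a set \<Rightarrow> 'a set set \<Rightarrow> bool" where
  "semicycle_free k V E \<longleftrightarrow>
     \<not> (\<exists>V' E'. subhypergraph V' E' V E \<and> semicycle k V' E')"

definition hypertree :: "nat \<Rightarrow> 'a set \<Rightarrow> 'a set set \<Rightarrow> bool" where
  "hypertree k V E \<longleftrightarrow>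
     uniform_hypergraph k V E \<and> chain_connected k V E \<and> semicycle_free k V E"

definition edge_minimal_hypertree :: "nat \<Rightarrow> 'a set \<Rightarrow> 'a set set \<Rightarrow> bool" where
  "edge_minimal_hypertree k V E \<longleftrightarrow>
     hypertree k V E \<and> (\<forall>e\<in>E. \<not> hypertree k V (E - {e}))"

end

theory Submission
  imports Defs
begin

text \<open>
  Choose, for every pair of vertices, a chain joining it. Deleting an edge that lies in none of
  the chosen chains would leave a hypertree, so by minimality the \<open>n choose 2\<close> chosen chains
  cover all edges. A repeated vertex in the sequence of a chain cuts out a semicycle, so in a
  hypertree the sequence of a chain has at most \<open>n\<close> entries and hence the chain has at most
  \<open>n - k + 1\<close> edges.
\<close>

lemma subhypergraph_trans:
  assumes "subhypergraph V' E' V E" and "subhypergraph W F V' E'"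
  shows "subhypergraph W F V E"
  using assms unfolding subhypergraph_def by blast

lemma uniform_hypergraph_subset:
  assumes "uniform_hypergraph k V E" and "F \<subseteq> E"
  shows "uniform_hypergraph k V F"
  using assms unfolding uniform_hypergraph_def by blast

lemma semicycle_free_subset:
  assumes "semicycle_free k V E" and "F \<subseteq> E"
  shows "semicycle_free k V F"
  using assms unfolding semicycle_free_def subhypergraph_def by (meson subset_trans)

lemma window_take_drop:
  assumes "i + k \<le> m" and "a + m \<le> length vs"
  shows "window k (take m (drop a vs)) i = window k vs (a + i)"
proof -
  have "{a + i..<a + i + k} = (+) a ` {i..<i + k}"
    by (simp add: ac_simps)
  then have "window k vs (a + i) = (\<lambda>j. vs ! (a + j)) ` {i..<i + k}"
    by (simp only: window_def image_image)
  then show ?thesis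
    using assms unfolding window_def by (auto intro!: image_cong)
qed

text \<open>The windows of a contiguous block are windows of \<open>vs\<close> shifted by the offset
  \<open>a\<close>, so their distinctness and their membership in \<open>E\<close> are inherited.
  The bound \<open>k \<le> m\<close> guarantees that the block has a window at all.\<close>

lemma window_sequence_infix:
  assumes ws: "window_sequence k V E vs" and k: "k \<le> m" and m: "a + m \<le> length vs"
  defines "us \<equiv> take m (drop a vs)"
  defines "F \<equiv> window k us ` {0..length us - k}"
  shows "window_sequence k (set us) F us" and "F \<subseteq> E"
proof -
  have len: "length us = m" using m by (simp add: us_def)
  have w: "window k us i = window k vs (a + i)" if "i \<in> {0..m - k}" for i
    using that k m unfolding us_def by (intro window_take_drop) auto
  have sub: "(+) a ` {0..m - k} \<subseteq> {0..length vs - k}"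
    using k m by auto
  have "inj_on (window k vs) {0..length vs - k}"
    using ws by (simp add: window_sequence_def)
  then have "inj_on (window k vs) ((+) a ` {0..m - k})"
    using sub by (rule inj_on_subset)
  then have "inj_on (window k vs \<circ> (+) a) {0..m - k}"
    by (intro comp_inj_on) auto
  then have "inj_on (window k us) {0..m - k}"
    by (subst inj_on_cong[of _ _ "window k vs \<circ> (+) a"]) (auto simp: w)
  then show "window_sequence k (set us) F us"
    using k len by (simp add: window_sequence_def F_def)
  have "E = window k vs ` {0..length vs - k}"
    using ws by (simp add: window_sequence_def)
  then show "F \<subseteq> E"
    using sub unfolding F_def len by (auto simp: w)
qed

lemma window_sequence_edge_subset:
  assumes "window_sequence k V E vs" and "e \<in> E"
  shows "e \<subseteq> V"
  using assms unfolding window_sequence_def window_def by fastforce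

text \<open>The segment of \<open>vs\<close> from one occurrence of a vertex to a later one starts
  and ends with the same vertex. Once it is known to be long enough to contain a window, it is a
  semicycle inside the hypergraph.\<close>

lemma window_sequence_distinct:
  assumes uni: "uniform_hypergraph k V E" and ws: "window_sequence k V E vs"
    and free: "semicycle_free k V E"
  shows "distinct vs"
proof (rule ccontr)
  assume "\<not> distinct vs"
  then obtain i j where ij: "i < j" "j < length vs" "vs ! i = vs ! j"
    by (metis distinct_conv_nth linorder_neqE_nat)
  have kl: "k \<le> length vs"
    using ws by (simp add: window_sequence_def)
  \<comment> \<open>Two positions at distance less than \<open>k\<close> lie in a common window, which has \<open>k\<close> elements.\<close>
  have far: "i + k \<le> j"
  proof (rule ccontr)
    assume near: "\<not> i + k \<le> j"
    \<comment> \<open>The window starting at \<open>i\<close> may run past the end of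
      \<open>vs\<close>; the last window then serves instead, and it still contains both
      positions.\<close>
    define s where "s = min i (length vs - k)"
    have s: "s \<le> length vs - k" "i \<in> {s..<s + k}" "j \<in> {s..<s + k}"
      using near ij kl by (auto simp: s_def)
    have "window k vs s \<in> E"
      using ws s(1) by (auto simp: window_sequence_def)
    then have "card ((!) vs ` {s..<s + k}) = card {s..<s + k}"
      using uni by (simp add: uniform_hypergraph_def window_def)
    then have "inj_on ((!) vs) {s..<s + k}"
      by (intro eq_card_imp_inj_on) auto
    then show False
      using s ij by (auto dest: inj_onD)
  qed
  \<comment> \<open>Both occurrences are kept, hence the \<open>+ 1\<close>; by \<open>far\<close>
    the segment has more than \<open>k\<close> entries.\<close>
  define us where "us = take (j - i + 1) (drop i vs)"
  define F where "F = window k us ` {0..length us - k}"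
  have us: "window_sequence k (set us) F us" and FE: "F \<subseteq> E"
    unfolding us_def F_def
    by (rule window_sequence_infix[OF ws]; use far ij in simp)+
  have "length us = j - i + 1"
    using ij by (simp add: us_def)
  moreover from this have "us \<noteq> []" by auto
  ultimately have "hd us = vs ! i" "last us = vs ! j"
    using ij by (auto simp: hd_conv_nth last_conv_nth us_def)
  then have ends: "hd us = last us"
    using ij by simp
  have FW: "\<forall>e\<in>F. e \<subseteq> set us"
    using us window_sequence_edge_subset by blast
  have "set us \<subseteq> V"
    using ws unfolding us_def window_sequence_def by (metis in_set_dropD in_set_takeD subsetI)
  then have "subhypergraph (set us) F V E"
    using FE FW by (simp add: subhypergraph_def)
  moreover have "semicycle k (set us) F"
    using uni us ends FE FW unfolding semicycle_def uniform_hypergraph_def by blast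
  ultimately show False
    using free unfolding semicycle_free_def by blast
qed

text \<open>The sequence of the chain has no repetition, so its length is \<open>card V'\<close>,
  and its windows are pairwise distinct. The additive form avoids truncated subtraction and also
  bounds \<open>k\<close> by \<open>card V + 1\<close> as soon as some chain exists.\<close>

lemma card_chain_edges:
  assumes "finite V" and free: "semicycle_free k V E"
    and sub: "subhypergraph V' E' V E" and ch: "chain k V' E'"
  shows "card E' + k \<le> card V + 1"
proof -
  obtain vs where ws: "window_sequence k V' E' vs"
    using ch by (auto simp: chain_def)
  have "semicycle_free k V' E'"
    using free sub subhypergraph_trans unfolding semicycle_free_def by metis
  then have "distinct vs"
    using ch ws window_sequence_distinct unfolding chain_def by blast
  then have "length vs = card V'"
    using ws by (metis distinct_card window_sequence_def)
  also have "\<dots> \<le> card V"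
    using assms by (simp add: card_mono subhypergraph_def)
  finally have "length vs \<le> card V" .
  moreover have "card E' = length vs - k + 1" "k \<le> length vs"
    using ws by (auto simp: window_sequence_def card_image)
  ultimately show ?thesis by simp
qed

lemma edge_minimal_hypertree_card:
  assumes min: "edge_minimal_hypertree k V E"
  shows "card E \<le> (card V choose 2) * (card V + 1 - k)"
proof -
  have uni: "uniform_hypergraph k V E" and conn: "chain_connected k V E"
    and free: "semicycle_free k V E"
    using min by (auto simp: edge_minimal_hypertree_def hypertree_def)
  have fin: "finite V"
    using uni by (simp add: uniform_hypergraph_def)
  \<comment> \<open>Unordered pairs are used, since one chain serves both orders; this yields the
    factor 1/2 in the final bound.\<close>
  define P where "P = {S. S \<subseteq> V \<and> card S = 2}"
  have finP: "finite P"
    using fin by (simp add: P_def)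
  \<comment> \<open>\<open>E'\<close> is quantified first so that the choice function
    \<open>C\<close> picks edge sets only; these are what has to cover \<open>E\<close>.\<close>
  have "\<forall>S\<in>P. \<exists>E'. \<exists>V'. subhypergraph V' E' V E \<and> chain k V' E' \<and> S \<subseteq> V'"
  proof
    fix S assume "S \<in> P"
    then obtain u v where S: "S = {u, v}" and "u \<noteq> v" "u \<in> V" "v \<in> V"
      by (auto simp: P_def card_2_iff)
    then obtain V' E' where "subhypergraph V' E' V E" "chain k V' E'" "u \<in> V'" "v \<in> V'"
      using conn unfolding chain_connected_def by meson
    then show "\<exists>E'. \<exists>V'. subhypergraph V' E' V E \<and> chain k V' E' \<and> S \<subseteq> V'"
      unfolding S by blast
  qed
  then obtain C where C: "\<forall>S\<in>P. \<exists>V'. subhypergraph V' (C S) V E \<and> chain k V' (C S) \<and> S \<subseteq> V'"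
    by metis
  have bound: "card (C S) \<le> card V + 1 - k" and finC: "finite (C S)" if S: "S \<in> P" for S
  proof -
    obtain V' where V': "subhypergraph V' (C S) V E" "chain k V' (C S)"
      using C S by blast
    then show "card (C S) \<le> card V + 1 - k"
      using card_chain_edges[OF fin free V'] by simp
    show "finite (C S)"
      using V'(2) by (auto simp: chain_def window_sequence_def)
  qed
  have "E \<subseteq> (\<Union>S\<in>P. C S)"
  proof
    fix e assume e: "e \<in> E"
    show "e \<in> (\<Union>S\<in>P. C S)"
    proof (rule ccontr)
      assume unused: "e \<notin> (\<Union>S\<in>P. C S)"
      \<comment> \<open>Uniformity and semicycle-freeness survive the deletion of an edge, so only
        connectedness is at stake. Every chosen chain avoids \<open>e\<close> and therefore remains
        available.\<close>
      have "chain_connected k V (E - {e})"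
        unfolding chain_connected_def
      proof (intro ballI impI)
        fix u v assume uv: "u \<in> V" "v \<in> V" "u \<noteq> v"
        then have S: "{u, v} \<in> P"
          by (auto simp: P_def)
        then obtain V' where "subhypergraph V' (C {u, v}) V E" "chain k V' (C {u, v})" "{u, v} \<subseteq> V'"
          using C by blast
        moreover from this have "subhypergraph V' (C {u, v}) V (E - {e})"
          using unused S by (auto simp: subhypergraph_def)
        ultimately show "\<exists>V' E'. subhypergraph V' E' V (E - {e}) \<and> chain k V' E' \<and> u \<in> V' \<and> v \<in> V'"
          by blast
      qed
      then have "hypertree k V (E - {e})"
        using uniform_hypergraph_subset[OF uni] semicycle_free_subset[OF free]
        by (simp add: hypertree_def Diff_subset)
      then show False
        using min e by (simp add: edge_minimal_hypertree_def)
    qed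
  qed
  then have "card E \<le> card (\<Union>S\<in>P. C S)"
    using finP finC by (intro card_mono) auto
  also have "\<dots> \<le> (\<Sum>S\<in>P. card (C S))"
    using finP by (rule card_UN_le)
  also have "\<dots> \<le> card P * (card V + 1 - k)"
    using sum_bounded_above[of P "\<lambda>S. card (C S)" "card V + 1 - k"] bound by simp
  also have "card P = card V choose 2"
    using fin by (simp add: P_def n_subsets)
  finally show ?thesis .
qed

theorem theorem9:
  fixes V :: "'a set" and E :: "'a set set" and k n :: nat
  assumes "k \<ge> 2"
    and "edge_minimal_hypertree k V E"
    and "n = card V"
  shows "real (card E) \<le> real n * (real n - 1) * (real n - real k + 1) / 2"
proof -
  have fin: "finite V" and conn: "chain_connected k V E"
    using assms(2) by (auto simp: edge_minimal_hypertree_def hypertree_def uniform_hypergraph_def)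
  have card: "card E \<le> (n choose 2) * (n + 1 - k)"
    using edge_minimal_hypertree_card assms by blast
  have choose: "real (n choose 2) = real n * (real n - 1) / 2"
    by (induction n) (auto simp: numeral_2_eq_2 field_simps)
  \<comment> \<open>Passing to real subtraction in \<open>n + 1 - k\<close> requires
    \<open>k \<le> n + 1\<close>, which any chain provides. With at most one vertex there is no pair
    to be joined by a chain, but then \<open>n choose 2\<close> vanishes and both sides are
    0.\<close>
  show ?thesis
  proof (cases "n \<le> 1")
    case True
    then have "card E = 0" "n = 0 \<or> n = 1"
      using card by (auto simp: binomial_eq_0)
    then show ?thesis by auto
  next
    case False
    then have "1 < card V"
      using assms(3) by simp
    then obtain u v where "u \<in> V" "v \<in> V" "u \<noteq> v"
      using card_le_Suc0_iff_eq[OF fin] by (metis One_nat_def not_le)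
    then obtain V' E' where sub: "subhypergraph V' E' V E" and ch: "chain k V' E'"
      using conn unfolding chain_connected_def by metis
    have "semicycle_free k V E"
      using assms(2) by (simp add: edge_minimal_hypertree_def hypertree_def)
    from card_chain_edges[OF fin this sub ch] have "k \<le> n + 1"
      using assms(3) by simp
    then have "real (n + 1 - k) = real n - real k + 1"
      by simp
    moreover have "real (card E) \<le> real (n choose 2) * real (n + 1 - k)"
      using card by (metis of_nat_le_iff of_nat_mult)
    ultimately show ?thesis
      by (simp add: choose)
  qed
qed

end
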